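(* For any $a_0\in\mathbb{C}\setminus\{0\}$, there exists a unique formal solution of the equation $$H''(r)=\frac{(H'(r))^2}{H(r)}-\frac{H'(r)}{r}+\frac1r\left((H(r))^2-\frac{1}{H(r)}\right)$$ of the form $$H(r)=-a_0+\sum_{k=1}^{\infty}a_k r^k,$$ where the coefficients $a_k\in\mathbb{C}$ are independent of $r$.
   Context: The prime denotes differentiation with respect to $r$. A formal solution is a formal power series in $r$ satisfying the equation identically in powers of $r$. *)

theory Defs
  imports Complex_Main "HOL-Computational_Algebra.Formal_Laurent_Series"
begin

text \<open>
  A formal solution is a power series, but the terms with the factor \<open>1 / r\<close> need not be
  power series individually. The equation is therefore read in the field of formal Laurent
  series, with \<open>r\<close> the indeterminate \<^const>\<open>fls_X\<close>. The condition \<open>H \<noteq> 0\<close> gives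
  the divisions by \<open>H\<close> their usual meaning, since Isabelle sets \<open>x / 0 = 0\<close>.
\<close>

definition formal_solution :: "complex fps \<Rightarrow> bool" where
  "formal_solution H \<longleftrightarrow> H \<noteq> 0 \<and>
    (let h = fps_to_fls H; h' = fls_deriv h; h'' = fls_deriv h'; r = fls_X
     in h'' = h'\<^sup>2 / h - h' / r + (1 / r) * (h\<^sup>2 - 1 / h))"

end

theory Submission
  imports Defs
begin

text \<open>
  Clearing denominators turns the equation into \<open>H (r H')' = r H'\<^sup>2 + H\<^sup>3 - 1\<close>. The coefficient of
  \<open>r\<^sup>n\<close> in \<open>(r H')'\<close> is \<open>(n + 1)\<^sup>2 a\<^bsub>n+1\<^esub>\<close>, so comparing coefficients of \<open>r\<^sup>n\<close> expresses
  \<open>(n + 1)\<^sup>2 H(0) a\<^bsub>n+1\<^esub>\<close> through \<open>a\<^bsub>0\<^esub>, \<dots>, a\<^bsub>n\<^esub>\<close>. Since \<open>H(0) \<noteq> 0\<close>, this recursion has exactly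
  one solution.
\<close>

text \<open>Since coefficient \<open>n\<close> of \<open>\<Phi> F\<close> depends only on the
  coefficients of \<open>F\<close> below \<open>n\<close>, the fixed-point equation is a
  course-of-values recursion: well-founded choice builds a solution, and strong induction shows that
  any two agree.\<close>

lemma fps_causal_ex1_fixpoint:
  fixes \<Phi> :: "'a::zero fps \<Rightarrow> 'a fps"
  assumes causal: "\<And>F G n. (\<And>k. k < n \<Longrightarrow> fps_nth F k = fps_nth G k) \<Longrightarrow>
    fps_nth (\<Phi> F) n = fps_nth (\<Phi> G) n"
  shows "\<exists>!F. \<Phi> F = F"
proof (rule ex_ex1I)
  have "\<exists>f. \<forall>n. f n = fps_nth (\<Phi> (Abs_fps f)) n"
  proof (rule dependent_wellorder_choice)
    fix r and f g :: "nat \<Rightarrow> 'a" and n :: nat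
    assume "\<And>m. m < n \<Longrightarrow> f m = g m"
    then have "fps_nth (\<Phi> (Abs_fps f)) n = fps_nth (\<Phi> (Abs_fps g)) n"
      by (intro causal) simp
    then show "(r = fps_nth (\<Phi> (Abs_fps f)) n) = (r = fps_nth (\<Phi> (Abs_fps g)) n)"
      by simp
  qed simp
  then obtain f where "\<forall>n. f n = fps_nth (\<Phi> (Abs_fps f)) n" ..
  then have "\<Phi> (Abs_fps f) = Abs_fps f"
    by (simp add: fps_eq_iff)
  then show "\<exists>F. \<Phi> F = F" ..
next
  fix F G
  assume fixed: "\<Phi> F = F" "\<Phi> G = G"
  have "fps_nth F n = fps_nth G n" for n
  proof (induction n rule: less_induct)
    case (less n)
    then show ?case
      using causal[of n F G] fixed by simp
  qed
  then show "F = G"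
    by (simp add: fps_eq_iff)
qed

lemma fps_mult_nth_cong:
  assumes "\<And>k. k \<le> n \<Longrightarrow> fps_nth F k = fps_nth F' k"
    and "\<And>k. k \<le> n \<Longrightarrow> fps_nth G k = fps_nth G' k"
  shows "fps_nth (F * G) n = fps_nth (F' * G') n"
  using assms by (auto simp: fps_mult_nth intro!: sum.cong)

text \<open>Multiplication by \<open>r * h\<close> clears all denominators and, as
  \<open>r * h\<close> is nonzero, loses no information.\<close>

lemma field_equation_iff:
  fixes h r :: "'a::field"
  assumes "h \<noteq> 0" and "r \<noteq> 0"
  shows "h2 = h1\<^sup>2 / h - h1 / r + (1 / r) * (h\<^sup>2 - 1 / h) \<longleftrightarrow>
    h * (h1 + r * h2) = r * h1\<^sup>2 + h ^ 3 - 1"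
proof -
  have "r * h * (h1\<^sup>2 / h - h1 / r + (1 / r) * (h\<^sup>2 - 1 / h)) = r * h1\<^sup>2 - h * h1 + (h ^ 3 - 1)"
    using assms by (simp add: field_simps power2_eq_square power3_eq_cube)
  moreover have "r * h \<noteq> 0"
    using assms by simp
  ultimately have "h2 = h1\<^sup>2 / h - h1 / r + (1 / r) * (h\<^sup>2 - 1 / h) \<longleftrightarrow>
      r * h * h2 = r * h1\<^sup>2 - h * h1 + (h ^ 3 - 1)"
    by (metis mult_left_cancel)
  also have "\<dots> \<longleftrightarrow> h * (h1 + r * h2) = r * h1\<^sup>2 + h ^ 3 - 1"
    by (auto simp: algebra_simps)
  finally show ?thesis .
qed

text \<open>Once denominators are cleared, both sides are images of power series, and the embedding
  into Laurent series is injective. The sum \<open>H' + r H''\<close> is then folded into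
  \<open>(r H')'\<close>.\<close>

lemma formal_solution_iff:
  "formal_solution H \<longleftrightarrow>
    H \<noteq> 0 \<and> H * fps_deriv (fps_X * fps_deriv H) = fps_X * (fps_deriv H)\<^sup>2 + H ^ 3 - 1"
proof (cases "H = 0")
  case False
  define h h1 h2 where "h = fps_to_fls H" and "h1 = fps_to_fls (fps_deriv H)"
    and "h2 = fps_to_fls (fps_deriv (fps_deriv H))"
  have h: "h \<noteq> 0" and X: "fls_X \<noteq> (0 :: complex fls)"
    using False by (simp_all add: h_def)
  have "formal_solution H \<longleftrightarrow> h2 = h1\<^sup>2 / h - h1 / fls_X + (1 / fls_X) * (h\<^sup>2 - 1 / h)"
    unfolding formal_solution_def Let_def h_def h1_def h2_def fls_deriv_fps_to_fls
    using False by (simp only: simp_thms not_False_eq_True)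
  also have "\<dots> \<longleftrightarrow> h * (h1 + fls_X * h2) = fls_X * h1\<^sup>2 + h ^ 3 - 1"
    by (rule field_equation_iff[OF h X])
  also have "\<dots> \<longleftrightarrow> fps_to_fls (H * (fps_deriv H + fps_X * fps_deriv (fps_deriv H))) =
      fps_to_fls (fps_X * (fps_deriv H)\<^sup>2 + H ^ 3 - 1)"
    by (simp add: h_def h1_def h2_def fls_times_fps_to_fls fps_to_fls_power flip: fps_X_to_fls)
  also have "\<dots> \<longleftrightarrow> H * fps_deriv (fps_X * fps_deriv H) = fps_X * (fps_deriv H)\<^sup>2 + H ^ 3 - 1"
    by (simp only: fps_to_fls_eq_iff) (simp add: add.commute)
  finally show ?thesis
    using False by simp
qed (simp add: formal_solution_def)

lemma fps_nth_deriv_X_deriv: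
  fixes H :: "'a::comm_ring_1 fps"
  shows "fps_nth (fps_deriv (fps_X * fps_deriv H)) n = (of_nat (Suc n))\<^sup>2 * fps_nth H (Suc n)"
  by (simp add: power2_eq_square algebra_simps)

text \<open>
  With \<open>H = H(0) + r S\<close> the equation reads \<open>H(0) (r H')' = recursion_rhs H\<close>.
\<close>

definition recursion_rhs :: "'a::comm_ring_1 fps \<Rightarrow> 'a fps" where
  "recursion_rhs H = fps_X * ((fps_deriv H)\<^sup>2 - fps_shift 1 H * fps_deriv (fps_X * fps_deriv H)) + H ^ 3 - 1"

text \<open>The derivatives and the shift look one coefficient ahead, but they occur only under the
  factor \<open>fps_X\<close>, which moves the index back by one.\<close>

lemma recursion_rhs_nth_cong:
  assumes "\<And>k. k \<le> n \<Longrightarrow> fps_nth F k = fps_nth G k"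
  shows "fps_nth (recursion_rhs F) n = fps_nth (recursion_rhs G) n"
proof -
  have "fps_nth (F ^ 3) n = fps_nth (G ^ 3) n"
    unfolding power3_eq_cube using assms by (intro fps_mult_nth_cong) auto
  moreover have "fps_nth ((fps_deriv F)\<^sup>2) m = fps_nth ((fps_deriv G)\<^sup>2) m" if "n = Suc m" for m
    unfolding power2_eq_square using assms that by (intro fps_mult_nth_cong) auto
  moreover have "fps_nth (fps_shift 1 F * fps_deriv (fps_X * fps_deriv F)) m =
      fps_nth (fps_shift 1 G * fps_deriv (fps_X * fps_deriv G)) m" if "n = Suc m" for m
    using assms that by (intro fps_mult_nth_cong) (auto simp only: fps_nth_deriv_X_deriv fps_shift_nth)
  ultimately show ?thesis
    unfolding recursion_rhs_def by (cases n) (simp_all del: fps_deriv_mult)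
qed

text \<open>In degree \<open>n\<close> the left-hand product contains the coefficient of index
  \<open>n + 1\<close> only through \<open>H(0)\<close>. Moving the remaining part
  \<open>r S (r H')'\<close> to the right isolates that coefficient.\<close>

lemma cleared_equation_iff:
  "H * fps_deriv (fps_X * fps_deriv H) = fps_X * (fps_deriv H)\<^sup>2 + H ^ 3 - 1 \<longleftrightarrow>
    fps_const (fps_nth H 0) * fps_deriv (fps_X * fps_deriv H) = recursion_rhs H"
  (is "H * ?D = ?R \<longleftrightarrow> _")
proof -
  have "H = fps_const (fps_nth H 0) + fps_X * fps_shift 1 H"
    by (rule fps_ext) (simp add: fps_X_mult_nth)
  then have "H * ?D = fps_const (fps_nth H 0) * ?D + fps_X * (fps_shift 1 H * ?D)"
    by (metis distrib_right mult.assoc)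
  then show ?thesis
    unfolding recursion_rhs_def by (auto simp only: algebra_simps)
qed

theorem proposition2p1:
  fixes a\<^sub>0 :: complex
  assumes "a\<^sub>0 \<noteq> 0"
  shows "\<exists>!H :: complex fps. formal_solution H \<and> fps_nth H 0 = - a\<^sub>0"
proof -
  \<comment> \<open>The degree \<open>m\<close> equation is solved for the coefficient of index
    \<open>m + 1\<close>, and index 0 carries the prescribed constant term. Fixed points of
    \<open>\<Phi>\<close> are thus the required solutions.\<close>
  define \<Phi> where "\<Phi> H = Abs_fps (\<lambda>n. case n of 0 \<Rightarrow> - a\<^sub>0
    | Suc m \<Rightarrow> fps_nth (recursion_rhs H) m / (- a\<^sub>0 * (of_nat (Suc m))\<^sup>2))" for H
  \<comment> \<open>Agreement below \<open>n\<close> is agreement up to \<open>n - 1\<close> when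
    \<open>n > 0\<close>; for \<open>n = 0\<close> the coefficient is constant.\<close>
  have "fps_nth (\<Phi> F) n = fps_nth (\<Phi> G) n" if "\<And>k. k < n \<Longrightarrow> fps_nth F k = fps_nth G k" for F G n
    using that recursion_rhs_nth_cong[of "n - 1" F G] by (cases n) (auto simp: \<Phi>_def)
  then have "\<exists>!H. \<Phi> H = H"
    by (rule fps_causal_ex1_fixpoint)
  moreover have "\<Phi> H = H \<longleftrightarrow> formal_solution H \<and> fps_nth H 0 = - a\<^sub>0" for H
  proof -
    have \<Phi>_Suc: "- a\<^sub>0 * ((of_nat (Suc m))\<^sup>2 * fps_nth H (Suc m)) = fps_nth (recursion_rhs H) m \<longleftrightarrow>
        fps_nth (\<Phi> H) (Suc m) = fps_nth H (Suc m)" for m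
    proof -
      \<comment> \<open>The division in \<open>\<Phi>\<close> is genuine because
        \<open>a\<^sub>0 \<noteq> 0\<close> and the characteristic is zero.\<close>
      have "- a\<^sub>0 * (of_nat (Suc m))\<^sup>2 \<noteq> 0"
        using assms by (simp del: of_nat_Suc)
      from nonzero_divide_eq_eq[OF this] show ?thesis
        unfolding \<Phi>_def by (auto simp: mult_ac simp del: of_nat_Suc)
    qed
    have "formal_solution H \<and> fps_nth H 0 = - a\<^sub>0 \<longleftrightarrow> fps_nth H 0 = - a\<^sub>0 \<and>
        fps_const (- a\<^sub>0) * fps_deriv (fps_X * fps_deriv H) = recursion_rhs H"
      using assms unfolding formal_solution_iff cleared_equation_iff by (metis fps_zero_nth neg_equal_0_iff_equal)
    also have "\<dots> \<longleftrightarrow> fps_nth H 0 = - a\<^sub>0 \<and>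
        (\<forall>m. - a\<^sub>0 * ((of_nat (Suc m))\<^sup>2 * fps_nth H (Suc m)) = fps_nth (recursion_rhs H) m)"
      by (simp only: fps_eq_iff fps_mult_left_const_nth fps_nth_deriv_X_deriv)
    also have "\<dots> \<longleftrightarrow> fps_nth (\<Phi> H) 0 = fps_nth H 0 \<and>
        (\<forall>m. fps_nth (\<Phi> H) (Suc m) = fps_nth H (Suc m))"
      unfolding \<Phi>_Suc by (auto simp: \<Phi>_def)
    also have "\<dots> \<longleftrightarrow> (\<forall>n. fps_nth (\<Phi> H) n = fps_nth H n)"
      by (metis not0_implies_Suc)
    finally show ?thesis
      by (simp add: fps_eq_iff)
  qed
  ultimately show ?thesis
    by simp
qed

end
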